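(* Let $F \in H(G)$ be a non-zero function on a planar domain $G$. Define a weight $v$ on $G$ by $v(z):=0$ if $F(z)=0$ and $v(z):=1/|F(z)|$ if $F(z) \neq 0$. Then $H^\infty_v(G)$ is a Banach space that coincides with the set of all $f \in H(G)$ such that there is $C=C(f)>0$ with $|f(z)| \leq C |F(z)|$ for each $z \in G$.
   Context: A planar domain is a (nonempty) open connected subset $G$ of $\mathbb{C}$. $H(G)$ is the space of holomorphic functions on $G$; "non-zero function" means not identically zero. For a function $v:G\to[0,\infty[$ (a weight), $H^\infty_v(G):=\{f\in H(G) : \|f\|_v:=\sup_{z\in G} v(z)|f(z)|<+\infty\}$, endowed with the seminorm $\|\cdot\|_v$; saying it is a Banach space means that $\|\cdot\|_v$ is a norm and is complete. *)

theory Defs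
  imports "HOL-Complex_Analysis.Complex_Analysis" "HOL-Library.Function_Algebras"
begin

definition planar_domain :: "complex set \<Rightarrow> bool" where
  "planar_domain G \<longleftrightarrow> G \<noteq> {} \<and> open G \<and> connected G"

text \<open>A function on \<open>G\<close> is represented by its extension by 0 to all of \<open>\<complex>\<close>. This makes equality
  in \<open>H(G)\<close> the same as equality on \<open>G\<close> (needed for the seminorm to be definite), and the
  pointwise operations of Function_Algebras the operations of \<open>H(G)\<close>.\<close>

definition holo_space :: "complex set \<Rightarrow> (complex \<Rightarrow> complex) set" where
  "holo_space G = {f. f holomorphic_on G \<and> (\<forall>z. z \<notin> G \<longrightarrow> f z = 0)}"

definition scale_fun :: "complex \<Rightarrow> (complex \<Rightarrow> complex) \<Rightarrow> complex \<Rightarrow> complex" where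
  "scale_fun c f = (\<lambda>z. c * f z)"

text \<open>The supremum is a real one, so it is meaningful only where the set is bounded above, i.e. on
  \<open>Hinf\<close> below, where boundedness expresses finiteness of the extended-real supremum.\<close>

definition weighted_norm :: "complex set \<Rightarrow> (complex \<Rightarrow> real) \<Rightarrow> (complex \<Rightarrow> complex) \<Rightarrow> real" where
  "weighted_norm G v f = (SUP z\<in>G. v z * cmod (f z))"

definition Hinf :: "complex set \<Rightarrow> (complex \<Rightarrow> real) \<Rightarrow> (complex \<Rightarrow> complex) set" where
  "Hinf G v = {f \<in> holo_space G. bdd_above ((\<lambda>z. v z * cmod (f z)) ` G)}"

text \<open>The library's Banach spaces are real and live on whole types; this is the complex notion for a
  linear subspace \<open>V\<close> of an ambient complex vector space with scalar multiplication \<open>s\<close>, normed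
  by \<open>N\<close>, whose values outside \<open>V\<close> are irrelevant.\<close>

definition complex_norm_on ::
    "(complex \<Rightarrow> 'b::ab_group_add \<Rightarrow> 'b) \<Rightarrow> 'b set \<Rightarrow> ('b \<Rightarrow> real) \<Rightarrow> bool" where
  "complex_norm_on s V N \<longleftrightarrow>
     (\<forall>f\<in>V. 0 \<le> N f) \<and>
     (\<forall>f\<in>V. N f = 0 \<longleftrightarrow> f = 0) \<and>
     (\<forall>c. \<forall>f\<in>V. N (s c f) = cmod c * N f) \<and>
     (\<forall>f\<in>V. \<forall>g\<in>V. N (f + g) \<le> N f + N g)"

definition norm_complete_on :: "'b::ab_group_add set \<Rightarrow> ('b \<Rightarrow> real) \<Rightarrow> bool" where
  "norm_complete_on V N \<longleftrightarrow>
     (\<forall>X::nat \<Rightarrow> 'b. (\<forall>n. X n \<in> V) \<longrightarrow>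
        (\<forall>e>0. \<exists>M. \<forall>m\<ge>M. \<forall>n\<ge>M. N (X m - X n) < e) \<longrightarrow>
        (\<exists>f\<in>V. (\<lambda>n. N (X n - f)) \<longlonglongrightarrow> 0))"

definition complex_Banach_on ::
    "(complex \<Rightarrow> 'b::ab_group_add \<Rightarrow> 'b) \<Rightarrow> 'b set \<Rightarrow> ('b \<Rightarrow> real) \<Rightarrow> bool" where
  "complex_Banach_on s V N \<longleftrightarrow>
     vector_space s \<and> module.subspace s V \<and> complex_norm_on s V N \<and> norm_complete_on V N"

end

theory Submission imports Defs begin

text \<open>The weight \<open>v = 1/\<bar>F\<bar>\<close> discards the zeros of \<open>F\<close>, where it is set to \<open>0\<close>: a bound
  \<open>v \<bar>f\<bar> \<le> C\<close> says \<open>\<bar>f\<bar> \<le> C \<bar>F\<bar>\<close> only off these zeros. But \<open>F\<close> is a non-zero holomorphic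
  function on a connected set, so its zeros are isolated and each of them is a limit of points where
  the estimate is known; by continuity it holds there too (\<open>weighted_bound_iff_dominated\<close>).
  Consequently the weighted norm of \<open>f\<close> is the least \<open>C\<close> with \<open>\<bar>f\<bar> \<le> C \<bar>F\<bar>\<close> on all of \<open>G\<close>
  (\<open>weighted_norm_le_iff\<close>).

  Everything else is read off from this description. The description of the space
  and the norm axioms are immediate. For completeness, a Cauchy sequence \<open>X\<close> satisfies
  \<open>\<bar>X m - X n\<bar> \<le> e \<bar>F\<bar>\<close> for large \<open>m\<close> and \<open>n\<close>. As \<open>F\<close> is bounded on compact sets, \<open>X\<close> converges
  locally uniformly, so its limit is holomorphic by Weierstrass; letting \<open>n\<close> tend to infinity in
  the estimate shows that the convergence takes place in the weighted norm.\<close>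

section \<open>Functions on the plane as a complex vector space\<close>

lemma vector_space_scale_fun: "vector_space scale_fun"
  by unfold_locales (auto simp: scale_fun_def fun_eq_iff algebra_simps)

lemma holo_space_zero: "0 \<in> holo_space G"
  by (auto simp: holo_space_def zero_fun_def)

lemma holo_space_add: "f \<in> holo_space G \<Longrightarrow> g \<in> holo_space G \<Longrightarrow> f + g \<in> holo_space G"
  by (auto simp: holo_space_def plus_fun_def intro!: holomorphic_intros)

lemma holo_space_scale: "f \<in> holo_space G \<Longrightarrow> scale_fun c f \<in> holo_space G"
  by (auto simp: holo_space_def scale_fun_def intro!: holomorphic_intros)

lemma holo_space_diff: "f \<in> holo_space G \<Longrightarrow> g \<in> holo_space G \<Longrightarrow> f - g \<in> holo_space G"
  by (auto simp: holo_space_def fun_diff_def intro!: holomorphic_intros)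

section \<open>The weight given by the reciprocal modulus of a holomorphic function\<close>

locale reciprocal_modulus_weight =
  fixes G :: "complex set" and F :: "complex \<Rightarrow> complex" and v :: "complex \<Rightarrow> real"
  assumes domain: "planar_domain G"
    and F_holo: "F holomorphic_on G"
    and F_nonzero: "\<exists>z\<in>G. F z \<noteq> 0"
    and weight: "\<And>z. z \<in> G \<Longrightarrow> v z = (if F z = 0 then 0 else 1 / cmod (F z))"
begin

lemma open_G: "open G" and connected_G: "connected G" and G_nonempty: "G \<noteq> {}"
  using domain by (auto simp: planar_domain_def)

text \<open>The punctured neighbourhoods of a zero of \<open>F\<close> eventually avoid the zero set, and non-strict
  inequalities between continuous functions pass to the limit.\<close>

lemma dominated_at_zeros:
  assumes f: "f holomorphic_on G"
    and le: "\<And>z. z \<in> G \<Longrightarrow> F z \<noteq> 0 \<Longrightarrow> cmod (f z) \<le> C * cmod (F z)"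
    and z: "z \<in> G"
  shows "cmod (f z) \<le> C * cmod (F z)"
proof -
  obtain b where b: "b \<in> G" "F b \<noteq> 0" using F_nonzero by blast
  have "\<forall>\<^sub>F w in at z. F w \<noteq> 0 \<and> w \<in> G"
    using non_zero_neighbour_alt[OF F_holo open_G connected_G z b] .
  then have ev: "\<forall>\<^sub>F w in at z. cmod (f w) \<le> C * cmod (F w)"
    by eventually_elim (use le in blast)
  have "(f \<longlongrightarrow> f z) (at z)" "(F \<longlongrightarrow> F z) (at z)"
    using f F_holo z open_G
    by (auto simp: continuous_on_eq_continuous_at isCont_def dest!: holomorphic_on_imp_continuous_on)
  then have "((\<lambda>w. cmod (f w)) \<longlongrightarrow> cmod (f z)) (at z)"
      "((\<lambda>w. C * cmod (F w)) \<longlongrightarrow> C * cmod (F z)) (at z)"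
    by (auto intro!: tendsto_intros)
  then show ?thesis using tendsto_le[OF _ _ _ ev] by auto
qed

text \<open>Off the zeros of \<open>F\<close> the two estimates are the same after division by \<open>\<bar>F\<bar>\<close>; at the zeros,
  domination follows by continuity. In the converse direction, the value \<open>v = 0\<close> at a zero of \<open>F\<close>
  demands \<open>C \<ge> 0\<close>, which is forced by a point where \<open>F\<close> does not vanish.\<close>

lemma weighted_bound_iff_dominated:
  assumes f: "f holomorphic_on G"
  shows "(\<forall>z\<in>G. v z * cmod (f z) \<le> C) \<longleftrightarrow> (\<forall>z\<in>G. cmod (f z) \<le> C * cmod (F z))"
proof
  assume "\<forall>z\<in>G. v z * cmod (f z) \<le> C"
  then have "cmod (f z) / cmod (F z) \<le> C" if "z \<in> G" "F z \<noteq> 0" for z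
    using that weight[of z] by (auto dest!: bspec)
  then have "cmod (f z) \<le> C * cmod (F z)" if "z \<in> G" "F z \<noteq> 0" for z
    using that by (simp add: pos_divide_le_eq)
  then show "\<forall>z\<in>G. cmod (f z) \<le> C * cmod (F z)"
    using dominated_at_zeros[OF f] by blast
next
  assume le: "\<forall>z\<in>G. cmod (f z) \<le> C * cmod (F z)"
  obtain b where b: "b \<in> G" "F b \<noteq> 0" using F_nonzero by blast
  have "0 \<le> C * cmod (F b)" using le b norm_ge_zero order_trans by blast
  then have "0 \<le> C" using b by (simp add: zero_le_mult_iff)
  then show "\<forall>z\<in>G. v z * cmod (f z) \<le> C"
    using le weight by (auto simp: field_simps)
qed

lemma Hinf_iff_dominated:
  "f \<in> Hinf G v \<longleftrightarrow> f \<in> holo_space G \<and> (\<exists>C. \<forall>z\<in>G. cmod (f z) \<le> C * cmod (F z))"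
proof -
  have "bdd_above ((\<lambda>z. v z * cmod (f z)) ` G) \<longleftrightarrow> (\<exists>C. \<forall>z\<in>G. v z * cmod (f z) \<le> C)"
    by (simp add: bdd_above_def)
  then show ?thesis
    by (auto simp: Hinf_def holo_space_def weighted_bound_iff_dominated cong: conj_cong)
qed

lemma Hinf_subset_holo_space: "f \<in> Hinf G v \<Longrightarrow> f \<in> holo_space G"
  by (simp add: Hinf_def)

lemma Hinf_eq_positively_dominated:
  "Hinf G v = {f \<in> holo_space G. \<exists>C>0. \<forall>z\<in>G. cmod (f z) \<le> C * cmod (F z)}"
proof -
  have "\<exists>C>0. \<forall>z\<in>G. cmod (f z) \<le> C * cmod (F z)"
    if "\<forall>z\<in>G. cmod (f z) \<le> C * cmod (F z)" for f :: "complex \<Rightarrow> complex" and C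
  proof (intro exI[of _ "max C 1"] conjI ballI)
    fix z assume "z \<in> G"
    then have "cmod (f z) \<le> C * cmod (F z)" using that by blast
    also have "\<dots> \<le> max C 1 * cmod (F z)" by (intro mult_right_mono) auto
    finally show "cmod (f z) \<le> max C 1 * cmod (F z)" .
  qed simp
  then show ?thesis unfolding Hinf_iff_dominated[abs_def] set_eq_iff mem_Collect_eq by blast
qed

text \<open>The working description of the norm: it is the least constant of domination by \<open>\<bar>F\<bar>\<close>, so
  norm estimates become pointwise estimates without suprema.\<close>

lemma weighted_norm_le_iff:
  assumes "f \<in> Hinf G v"
  shows "weighted_norm G v f \<le> C \<longleftrightarrow> (\<forall>z\<in>G. cmod (f z) \<le> C * cmod (F z))"
proof -
  have "weighted_norm G v f \<le> C \<longleftrightarrow> (\<forall>z\<in>G. v z * cmod (f z) \<le> C)"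
    unfolding weighted_norm_def using assms G_nonempty
    by (intro cSUP_le_iff) (auto simp: Hinf_def)
  also have "\<dots> \<longleftrightarrow> (\<forall>z\<in>G. cmod (f z) \<le> C * cmod (F z))"
    using assms by (intro weighted_bound_iff_dominated) (auto simp: Hinf_def holo_space_def)
  finally show ?thesis .
qed

lemma cmod_le_weighted_norm:
  assumes "f \<in> Hinf G v" "z \<in> G"
  shows "cmod (f z) \<le> weighted_norm G v f * cmod (F z)"
  using weighted_norm_le_iff[OF assms(1), of "weighted_norm G v f"] assms(2) by blast

section \<open>Vector space structure and norm axioms\<close>

lemma dominated_add:
  assumes "\<forall>z\<in>G. cmod (f z) \<le> C * cmod (F z)" "\<forall>z\<in>G. cmod (g z) \<le> D * cmod (F z)"
  shows "\<forall>z\<in>G. cmod ((f + g) z) \<le> (C + D) * cmod (F z)"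
proof
  fix z assume "z \<in> G"
  then have "cmod (f z) + cmod (g z) \<le> (C + D) * cmod (F z)"
    using assms by (auto simp: distrib_right intro!: add_mono)
  then show "cmod ((f + g) z) \<le> (C + D) * cmod (F z)"
    using norm_triangle_ineq[of "f z" "g z"] by simp
qed

lemma dominated_scale:
  assumes "\<forall>z\<in>G. cmod (f z) \<le> C * cmod (F z)"
  shows "\<forall>z\<in>G. cmod (scale_fun c f z) \<le> (cmod c * C) * cmod (F z)"
  using assms by (auto simp: scale_fun_def norm_mult mult.assoc intro!: mult_left_mono)

lemma Hinf_zero: "0 \<in> Hinf G v"
  by (auto simp: Hinf_iff_dominated holo_space_zero intro!: exI[of _ 0])

lemma Hinf_add: "f \<in> Hinf G v \<Longrightarrow> g \<in> Hinf G v \<Longrightarrow> f + g \<in> Hinf G v"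
  unfolding Hinf_iff_dominated using holo_space_add dominated_add by blast

lemma Hinf_scale: "f \<in> Hinf G v \<Longrightarrow> scale_fun c f \<in> Hinf G v"
  unfolding Hinf_iff_dominated using holo_space_scale dominated_scale by blast

lemma Hinf_diff:
  assumes "f \<in> Hinf G v" "g \<in> Hinf G v"
  shows "f - g \<in> Hinf G v"
proof -
  have "f - g = f + scale_fun (- 1) g" by (auto simp: fun_eq_iff scale_fun_def)
  then show ?thesis using assms Hinf_add Hinf_scale by metis
qed

lemma subspace_Hinf: "module.subspace scale_fun (Hinf G v)"
proof -
  interpret vector_space scale_fun by (rule vector_space_scale_fun)
  show ?thesis using Hinf_zero Hinf_add Hinf_scale by (auto simp: subspace_def)
qed

lemma weighted_norm_nonneg:
  assumes "f \<in> Hinf G v"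
  shows "0 \<le> weighted_norm G v f"
proof -
  obtain b where b: "b \<in> G" "F b \<noteq> 0" using F_nonzero by blast
  have "0 \<le> weighted_norm G v f * cmod (F b)"
    using cmod_le_weighted_norm[OF assms b(1)] norm_ge_zero order_trans by blast
  then show ?thesis using b by (simp add: zero_le_mult_iff)
qed

lemma weighted_norm_eq_0_iff:
  assumes f: "f \<in> Hinf G v"
  shows "weighted_norm G v f = 0 \<longleftrightarrow> f = 0"
proof -
  have "weighted_norm G v f = 0 \<longleftrightarrow> weighted_norm G v f \<le> 0"
    using weighted_norm_nonneg[OF f] by auto
  also have "\<dots> \<longleftrightarrow> (\<forall>z\<in>G. f z = 0)" using weighted_norm_le_iff[OF f] by simp
  also have "\<dots> \<longleftrightarrow> f = 0" using f by (auto simp: fun_eq_iff Hinf_def holo_space_def)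
  finally show ?thesis .
qed

lemma weighted_norm_scale_le:
  assumes "f \<in> Hinf G v"
  shows "weighted_norm G v (scale_fun c f) \<le> cmod c * weighted_norm G v f"
  unfolding weighted_norm_le_iff[OF Hinf_scale[OF assms]]
  by (intro dominated_scale ballI cmod_le_weighted_norm assms)

text \<open>Scaling by \<open>c\<close> is undone by scaling by \<open>1/c\<close>, so the inequality for all scalars
  implies equality.\<close>

lemma weighted_norm_scale:
  assumes f: "f \<in> Hinf G v"
  shows "weighted_norm G v (scale_fun c f) = cmod c * weighted_norm G v f"
proof (cases "c = 0")
  case True
  then have "scale_fun c f = 0" by (auto simp: scale_fun_def)
  then show ?thesis using True weighted_norm_eq_0_iff[OF Hinf_zero] by simp
next
  case False
  have "scale_fun (inverse c) (scale_fun c f) = f" using False by (auto simp: scale_fun_def)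
  then have "weighted_norm G v f \<le> cmod (inverse c) * weighted_norm G v (scale_fun c f)"
    using weighted_norm_scale_le[OF Hinf_scale[OF f], of "inverse c" c] by simp
  then have "cmod c * weighted_norm G v f
      \<le> cmod c * (cmod (inverse c) * weighted_norm G v (scale_fun c f))"
    by (intro mult_left_mono) auto
  also have "\<dots> = weighted_norm G v (scale_fun c f)" using False by (simp add: norm_inverse)
  finally show ?thesis using weighted_norm_scale_le[OF f, of c] by linarith
qed

lemma weighted_norm_triangle:
  assumes "f \<in> Hinf G v" "g \<in> Hinf G v"
  shows "weighted_norm G v (f + g) \<le> weighted_norm G v f + weighted_norm G v g"
  unfolding weighted_norm_le_iff[OF Hinf_add[OF assms]]
  by (intro dominated_add ballI cmod_le_weighted_norm assms)

lemma complex_norm_on_Hinf: "complex_norm_on scale_fun (Hinf G v) (weighted_norm G v)"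
  by (simp add: complex_norm_on_def weighted_norm_nonneg weighted_norm_eq_0_iff
      weighted_norm_scale weighted_norm_triangle)

section \<open>Completeness\<close>

text \<open>At each point, domination of the differences gives a Cauchy sequence of complex numbers, hence a
  candidate for the limit. The estimate survives the passage \<open>n \<rightarrow> \<infinity>\<close> with the same constant and
  the same index, which is the uniformity in \<open>z\<close> that the rest of the argument uses.\<close>

lemma dominated_Cauchy_limit:
  fixes X :: "nat \<Rightarrow> complex \<Rightarrow> complex"
  assumes Cauchy: "\<And>e. e > 0 \<Longrightarrow>
      \<exists>M. \<forall>m\<ge>M. \<forall>n\<ge>M. \<forall>z\<in>G. cmod (X m z - X n z) \<le> e * cmod (F z)"
  obtains g where "\<And>z. z \<notin> G \<Longrightarrow> g z = 0"
    and "\<And>e. e > 0 \<Longrightarrow> \<exists>M. \<forall>m\<ge>M. \<forall>z\<in>G. cmod (X m z - g z) \<le> e * cmod (F z)"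
proof
  define g where "g z = (if z \<in> G then lim (\<lambda>n. X n z) else 0)" for z
  show "g z = 0" if "z \<notin> G" for z using that by (simp add: g_def)
  have lim: "(\<lambda>n. X n z) \<longlonglongrightarrow> g z" if z: "z \<in> G" for z
  proof -
    have "Cauchy (\<lambda>n. X n z)"
    proof (rule CauchyI)
      fix e :: real assume e: "e > 0"
      \<comment> \<open>Adding 1 to the modulus keeps the divisor positive at a zero of \<open>F\<close>.\<close>
      define d where "d = e / (cmod (F z) + 1)"
      have pos: "cmod (F z) + 1 > 0" using norm_ge_zero[of "F z"] by linarith
      then have d: "d > 0" using e by (simp add: d_def)
      have "d * cmod (F z) < d * (cmod (F z) + 1)" using d by simp
      also have "\<dots> = e" using pos by (simp add: d_def)
      finally have lt: "d * cmod (F z) < e" .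
      obtain M where "\<forall>m\<ge>M. \<forall>n\<ge>M. cmod (X m z - X n z) \<le> d * cmod (F z)"
        using Cauchy[OF d] z by blast
      then show "\<exists>M. \<forall>m\<ge>M. \<forall>n\<ge>M. norm (X m z - X n z) < e"
        using lt by (meson le_less_trans)
    qed
    then have "convergent (\<lambda>n. X n z)" by (rule Cauchy_convergent)
    then show ?thesis using z by (simp add: g_def convergent_LIMSEQ_iff)
  qed
  fix e :: real assume "e > 0"
  then obtain M where M: "\<forall>m\<ge>M. \<forall>n\<ge>M. \<forall>z\<in>G. cmod (X m z - X n z) \<le> e * cmod (F z)"
    using Cauchy by blast
  have "cmod (X m z - g z) \<le> e * cmod (F z)" if "m \<ge> M" "z \<in> G" for m z
  proof (rule LIMSEQ_le_const2)
    show "(\<lambda>n. cmod (X m z - X n z)) \<longlonglongrightarrow> cmod (X m z - g z)"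
      using lim[OF that(2)] by (intro tendsto_intros)
    show "\<exists>N. \<forall>n\<ge>N. cmod (X m z - X n z) \<le> e * cmod (F z)" using M that by blast
  qed
  then show "\<exists>M. \<forall>m\<ge>M. \<forall>z\<in>G. cmod (X m z - g z) \<le> e * cmod (F z)" by blast
qed

text \<open>On a closed disc in \<open>G\<close> the function \<open>F\<close> is bounded, so smallness relative to \<open>\<bar>F\<bar>\<close> is uniform
  smallness there, and the limit theorem of Weierstrass applies.\<close>

lemma dominated_limit_holomorphic:
  fixes X :: "nat \<Rightarrow> complex \<Rightarrow> complex"
  assumes X: "\<And>n. X n holomorphic_on G"
    and conv: "\<And>e. e > 0 \<Longrightarrow> \<exists>M. \<forall>m\<ge>M. \<forall>z\<in>G. cmod (X m z - g z) \<le> e * cmod (F z)"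
  shows "g holomorphic_on G"
proof (rule holomorphic_uniform_sequence[OF open_G X])
  fix x assume "x \<in> G"
  then obtain d where d: "d > 0" "cball x d \<subseteq> G"
    using open_G open_contains_cball by blast
  have "continuous_on (cball x d) F"
    using F_holo d(2) holomorphic_on_imp_continuous_on continuous_on_subset by blast
  then have "bounded (F ` cball x d)"
    using compact_continuous_image compact_cball compact_imp_bounded by blast
  then obtain B where B: "B > 0" "\<And>z. z \<in> cball x d \<Longrightarrow> cmod (F z) \<le> B"
    by (auto simp: bounded_pos)
  have "uniform_limit (cball x d) X g sequentially"
  proof (rule uniform_limitI)
    fix e :: real assume e: "e > 0"
    then obtain M where M: "\<forall>m\<ge>M. \<forall>z\<in>G. cmod (X m z - g z) \<le> e / (2 * B) * cmod (F z)"
      using conv[of "e / (2 * B)"] B(1) by auto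
    have "dist (X m z) (g z) < e" if "m \<ge> M" "z \<in> cball x d" for m z
    proof -
      have "cmod (X m z - g z) \<le> e / (2 * B) * cmod (F z)" using M that d(2) by blast
      also have "\<dots> \<le> e / (2 * B) * B" using B that e by (intro mult_left_mono) auto
      also have "\<dots> < e" using B(1) e by simp
      finally show ?thesis by (simp add: dist_norm)
    qed
    then show "\<forall>\<^sub>F m in sequentially. \<forall>z\<in>cball x d. dist (X m z) (g z) < e"
      unfolding eventually_sequentially by blast
  qed
  then show "\<exists>d>0. cball x d \<subseteq> G \<and> uniform_limit (cball x d) X g sequentially"
    using d by blast
qed

lemma norm_complete_on_Hinf: "norm_complete_on (Hinf G v) (weighted_norm G v)"
  unfolding norm_complete_on_def
proof (intro allI impI)
  fix X :: "nat \<Rightarrow> complex \<Rightarrow> complex"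
  assume X: "\<forall>n. X n \<in> Hinf G v"
    and Cauchy: "\<forall>e>0. \<exists>M. \<forall>m\<ge>M. \<forall>n\<ge>M. weighted_norm G v (X m - X n) < e"
  have "\<exists>M. \<forall>m\<ge>M. \<forall>n\<ge>M. \<forall>z\<in>G. cmod (X m z - X n z) \<le> e * cmod (F z)" if "e > 0" for e
  proof -
    obtain M where M: "\<forall>m\<ge>M. \<forall>n\<ge>M. weighted_norm G v (X m - X n) < e"
      using Cauchy \<open>e > 0\<close> by blast
    have "\<forall>z\<in>G. cmod (X m z - X n z) \<le> e * cmod (F z)" if "m \<ge> M" "n \<ge> M" for m n
    proof -
      have "X m - X n \<in> Hinf G v" using X Hinf_diff by blast
      moreover have "weighted_norm G v (X m - X n) \<le> e" using M that less_imp_le by blast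
      ultimately show ?thesis by (simp add: weighted_norm_le_iff)
    qed
    then show ?thesis by blast
  qed
  then obtain g where g0: "\<And>z. z \<notin> G \<Longrightarrow> g z = 0"
    and g: "\<And>e. e > 0 \<Longrightarrow> \<exists>M. \<forall>m\<ge>M. \<forall>z\<in>G. cmod (X m z - g z) \<le> e * cmod (F z)"
    using dominated_Cauchy_limit[of X] by blast
  have X_holo: "X n \<in> holo_space G" for n using X Hinf_subset_holo_space by blast
  then have "g holomorphic_on G"
    by (intro dominated_limit_holomorphic[OF _ g]) (simp add: holo_space_def)
  then have g_space: "g \<in> holo_space G" using g0 by (simp add: holo_space_def)
  \<comment> \<open>Some difference \<open>X M - g\<close> is dominated, hence lies in the space, and so does
    \<open>g = X M - (X M - g)\<close>.\<close>
  obtain M where M: "\<forall>z\<in>G. cmod (X M z - g z) \<le> 1 * cmod (F z)"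
    using g[of 1] by auto
  have "X M - g \<in> Hinf G v"
    unfolding Hinf_iff_dominated using M X_holo g_space holo_space_diff
    by (auto intro!: exI[of _ 1])
  then have "X M - (X M - g) \<in> Hinf G v" using X Hinf_diff by blast
  then have g_Hinf: "g \<in> Hinf G v" by simp
  have "(\<lambda>n. weighted_norm G v (X n - g)) \<longlonglongrightarrow> 0"
  proof (rule LIMSEQ_I)
    fix e :: real assume "e > 0"
    then obtain M where M: "\<forall>m\<ge>M. \<forall>z\<in>G. cmod (X m z - g z) \<le> e / 2 * cmod (F z)"
      using g[of "e / 2"] by auto
    have "norm (weighted_norm G v (X m - g) - 0) < e" if "m \<ge> M" for m
    proof -
      have diff: "X m - g \<in> Hinf G v" using X g_Hinf Hinf_diff by blast
      have "weighted_norm G v (X m - g) \<le> e / 2"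
        unfolding weighted_norm_le_iff[OF diff] using M that by simp
      then show ?thesis using weighted_norm_nonneg[OF diff] \<open>e > 0\<close> by simp
    qed
    then show "\<exists>M. \<forall>m\<ge>M. norm (weighted_norm G v (X m - g) - 0) < e" by blast
  qed
  then show "\<exists>f\<in>Hinf G v. (\<lambda>n. weighted_norm G v (X n - f)) \<longlonglongrightarrow> 0"
    using g_Hinf by blast
qed

lemma complex_Banach_on_Hinf: "complex_Banach_on scale_fun (Hinf G v) (weighted_norm G v)"
  by (simp add: complex_Banach_on_def vector_space_scale_fun subspace_Hinf complex_norm_on_Hinf
      norm_complete_on_Hinf)

end

theorem proposition3p10:
  fixes G :: "complex set" and F :: "complex \<Rightarrow> complex" and v :: "complex \<Rightarrow> real"
  assumes "planar_domain G"
    and "F \<in> holo_space G"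
    and "\<exists>z\<in>G. F z \<noteq> 0"
    and "\<forall>z\<in>G. v z = (if F z = 0 then 0 else 1 / cmod (F z))"
  shows "complex_Banach_on scale_fun (Hinf G v) (weighted_norm G v) \<and>
         Hinf G v = {f \<in> holo_space G. \<exists>C>0. \<forall>z\<in>G. cmod (f z) \<le> C * cmod (F z)}"
proof -
  interpret reciprocal_modulus_weight G F v
    using assms by unfold_locales (auto simp: holo_space_def)
  show ?thesis using complex_Banach_on_Hinf Hinf_eq_positively_dominated by blast
qed

end
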